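(* Let $\kappa$ be an infinite cardinal and let $X$ be an initially $\kappa$-compact weakly Whyburn regular Hausdorff space such that $\chi(X) \leq \kappa^+$. Then $X$ is pseudoradial.
   Context: A space is initially $\kappa$-compact if every open cover of cardinality $\leq \kappa$ has a finite subcover. $\chi(X)$ denotes the character of $X$, i.e. the supremum over $x \in X$ of $\chi(x,X)$, the least cardinality of a local base at $x$. Given a space $X$, a set $B \subset X$ is an almost closed set converging to $x$ if $\overline{B} \setminus B = \{x\}$. A space $X$ is weakly Whyburn if for every non-closed set $A \subset X$ there is an almost closed set $B \subset A$ which converges to a point outside of $A$; equivalently, for every non-closed $A \subset X$ there is $B \subset A$ such that $\overline{B} \setminus A$ is a singleton. For an infinite cardinal $\lambda$, a transfinite sequence $\{x_\alpha : \alpha < \lambda\} \subset X$ converges to $x \in X$ if for every open neighbourhood $U$ of $x$ there is an ordinal $\beta < \lambda$ such that $\{x_\alpha : \beta < \alpha < \lambda\} \subset U$. A space $X$ is pseudoradial if for every non-closed set $A \subset X$ there are a point $x \in \overline{A} \setminus A$ and a transfinite sequence $\{x_\alpha : \alpha < \lambda\} \subset A$ ($\lambda$ an infinite cardinal) converging to $x$. *)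

theory Defs
  imports "HOL-Analysis.Analysis"
begin

unbundle cardinal_syntax

text \<open>Spaces are abstract topologies; cardinals are the cardinal orders of
  \<^theory>\<open>HOL.BNF_Cardinal_Order_Relation\<close>, compared by \<open>\<le>o\<close> across types.\<close>

definition initially_compact :: "'k rel \<Rightarrow> 'a topology \<Rightarrow> bool" where
  "initially_compact \<kappa> X \<longleftrightarrow>
     (\<forall>\<U>. (\<forall>U\<in>\<U>. openin X U) \<and> \<Union>\<U> = topspace X \<and> |\<U>| \<le>o \<kappa>
        \<longrightarrow> (\<exists>\<F>\<subseteq>\<U>. finite \<F> \<and> \<Union>\<F> = topspace X))"

definition local_base_at :: "'a topology \<Rightarrow> 'a \<Rightarrow> 'a set set \<Rightarrow> bool" where
  "local_base_at X x \<B> \<longleftrightarrow>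
     (\<forall>B\<in>\<B>. openin X B \<and> x \<in> B) \<and>
     (\<forall>U. openin X U \<and> x \<in> U \<longrightarrow> (\<exists>B\<in>\<B>. B \<subseteq> U))"

definition local_character :: "'a topology \<Rightarrow> 'a \<Rightarrow> 'a set rel" where
  "local_character X x =
     |SOME \<B>. local_base_at X x \<B> \<and> (\<forall>\<C>. local_base_at X x \<C> \<longrightarrow> |\<B>| \<le>o |\<C>| )|"

definition character_bound :: "'a topology \<Rightarrow> 'b rel \<Rightarrow> bool" where
  "character_bound X c \<longleftrightarrow> Card_order c \<and> (\<forall>x\<in>topspace X. local_character X x \<le>o c)"

text \<open>The least upper bound of the local characters.  It can be sought among the cardinals
  on \<^typ>\<open>'a set\<close> because \<open>|UNIV :: 'a set set|\<close> is one upper bound;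
  lemma \<open>character_ordLeq_iff\<close> below shows that it is the
  least upper bound among cardinals on every type.\<close>

definition character :: "'a topology \<Rightarrow> 'a set rel" where
  "character X =
     (SOME c. character_bound X c \<and> (\<forall>d :: 'a set rel. character_bound X d \<longrightarrow> c \<le>o d))"

definition almost_closed_converging :: "'a topology \<Rightarrow> 'a set \<Rightarrow> 'a \<Rightarrow> bool" where
  "almost_closed_converging X B x \<longleftrightarrow> B \<subseteq> topspace X \<and> X closure_of B - B = {x}"

definition weakly_Whyburn :: "'a topology \<Rightarrow> bool" where
  "weakly_Whyburn X \<longleftrightarrow>
     (\<forall>A\<subseteq>topspace X. \<not> closedin X A \<longrightarrow>
        (\<exists>B\<subseteq>A. \<exists>x. x \<notin> A \<and> almost_closed_converging X B x))"

text \<open>A sequence of length \<open>\<lambda>\<close> is a function on the field of the cardinal order \<open>l\<close>;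
  \<open>aboveS l b\<close> is the set of indices strictly above \<open>b\<close>.\<close>

definition transfinite_converges :: "'a topology \<Rightarrow> 'i rel \<Rightarrow> ('i \<Rightarrow> 'a) \<Rightarrow> 'a \<Rightarrow> bool" where
  "transfinite_converges X l s x \<longleftrightarrow>
     Card_order l \<and> infinite (Field l) \<and> s ` Field l \<subseteq> topspace X \<and> x \<in> topspace X \<and>
     (\<forall>U. openin X U \<and> x \<in> U \<longrightarrow> (\<exists>b\<in>Field l. s ` aboveS l b \<subseteq> U))"

text \<open>HOL cannot quantify over all index types inside a definition.  Indices from
  \<^typ>\<open>'a + nat\<close> lose nothing: by lemma \<open>pseudoradial_witnessI\<close> below, a convergent sequence
  whose length is an infinite cardinal on any type can be replaced by one with such indices.\<close>

definition pseudoradial :: "'a topology \<Rightarrow> bool" where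
  "pseudoradial X \<longleftrightarrow>
     (\<forall>A\<subseteq>topspace X. \<not> closedin X A \<longrightarrow>
        (\<exists>x \<in> X closure_of A - A. \<exists>(l :: ('a + nat) rel) s.
           s ` Field l \<subseteq> A \<and> transfinite_converges X l s x))"

lemma local_character_ordLeq_iff:
  assumes "x \<in> topspace X"
  shows "local_character X x \<le>o r \<longleftrightarrow> (\<exists>\<B>. local_base_at X x \<B> \<and> |\<B>| \<le>o r)"
proof -
  let ?R = "{|\<B>| | \<B>. local_base_at X x \<B>}"
  let ?P = "\<lambda>\<B>. local_base_at X x \<B> \<and> (\<forall>\<C>. local_base_at X x \<C> \<longrightarrow> |\<B>| \<le>o |\<C>| )"
  have "local_base_at X x {U. openin X U \<and> x \<in> U}"
    by (auto simp: local_base_at_def)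
  then have "?R \<noteq> {}" by blast
  moreover have "\<forall>r\<in>?R. Card_order r" using card_of_Card_order by blast
  ultimately have "\<exists>r\<in>?R. \<forall>r'\<in>?R. r \<le>o r'" by (rule exists_minim_Card_order)
  then have "\<exists>\<B>. ?P \<B>" by blast
  then have "?P (SOME \<B>. ?P \<B>)" by (rule someI_ex)
  then show ?thesis
    unfolding local_character_def by (meson ordLeq_transitive)
qed

lemma character_ordLeq_iff:
  fixes X :: "'a topology" and r :: "'b rel"
  assumes r: "Card_order r"
  shows "character X \<le>o r \<longleftrightarrow> (\<forall>x\<in>topspace X. local_character X x \<le>o r)"
proof -
  let ?R = "{c :: 'a set rel. character_bound X c}"
  let ?P = "\<lambda>c :: 'a set rel. character_bound X c \<and> (\<forall>d :: 'a set rel. character_bound X d \<longrightarrow> c \<le>o d)"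
  have U: "character_bound X |UNIV :: 'a set set|"
    by (simp add: character_bound_def local_character_def card_of_Card_order card_of_mono1)
  have "?R \<noteq> {}" using U by blast
  moreover have "\<forall>r\<in>?R. Card_order r" by (simp add: character_bound_def)
  ultimately have "\<exists>r\<in>?R. \<forall>r'\<in>?R. r \<le>o r'" by (rule exists_minim_Card_order)
  then have "\<exists>c. ?P c" by auto
  then have P: "?P (character X)" unfolding character_def by (rule someI_ex)
  show ?thesis
  proof
    assume "character X \<le>o r"
    with P show "\<forall>x\<in>topspace X. local_character X x \<le>o r"
      unfolding character_bound_def by (meson ordLeq_transitive)
  next
    assume bd: "\<forall>x\<in>topspace X. local_character X x \<le>o r"
    show "character X \<le>o r"
    proof (cases "|UNIV :: 'a set set| \<le>o r")
      case True
      with P U show ?thesis by (meson ordLeq_transitive)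
    next
      case False
      then have "r \<le>o |UNIV :: 'a set set|"
        using r ordLeq_total[OF card_of_Well_order card_order_on_well_order_on] by blast
      then have "|Field r| \<le>o |UNIV :: 'a set set|"
        using ordIso_ordLeq_trans[OF card_of_Field_ordIso[OF r]] by blast
      then obtain f :: "'b \<Rightarrow> 'a set" where f: "inj_on f (Field r)"
        using card_of_ordLeq[of "Field r" "UNIV :: 'a set set"] by blast
      have iso: "|f ` Field r| =o r"
        using card_of_ordIsoI[OF inj_on_imp_bij_betw[OF f]] card_of_Field_ordIso[OF r]
        by (meson ordIso_symmetric ordIso_transitive)
      have "character_bound X |f ` Field r|"
        using bd iso card_of_Card_order
        unfolding character_bound_def by (meson ordIso_symmetric ordLeq_ordIso_trans)
      with P iso show ?thesis by (meson ordLeq_ordIso_trans)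
    qed
  qed
qed

lemma pseudoradial_witnessI:
  fixes X :: "'a topology" and l :: "'i rel"
  assumes conv: "transfinite_converges X l s x" and sA: "s ` Field l \<subseteq> A"
  shows "\<exists>(l' :: ('a + nat) rel) s'. s' ` Field l' \<subseteq> A \<and> transfinite_converges X l' s' x"
proof -
  have l: "Card_order l" "infinite (Field l)"
    and top: "s ` Field l \<subseteq> topspace X" "x \<in> topspace X"
    and nb: "\<And>U. openin X U \<Longrightarrow> x \<in> U \<Longrightarrow> \<exists>b\<in>Field l. s ` aboveS l b \<subseteq> U"
    using conv by (auto simp: transfinite_converges_def)
  have wo: "wo_rel l"
    using l(1) by (simp add: card_order_on_well_order_on wo_rel_def)
  have tr: "\<And>a b c. (a,b) \<in> l \<Longrightarrow> (b,c) \<in> l \<Longrightarrow> (a,c) \<in> l"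
    using wo_rel.TRANS[OF wo] by (meson transD)
  have an: "\<And>a b. (a,b) \<in> l \<Longrightarrow> (b,a) \<in> l \<Longrightarrow> a = b"
    using wo_rel.ANTISYM[OF wo] by (meson antisymD)
  have tot: "\<And>a b. a \<in> Field l \<Longrightarrow> b \<in> Field l \<Longrightarrow> (a,b) \<in> l \<or> (b,a) \<in> l"
    using wo_rel.TOTALS[OF wo] by blast
  have nomax: "\<And>a. a \<in> Field l \<Longrightarrow> \<exists>b\<in>Field l. a \<noteq> b \<and> (a,b) \<in> l"
    using infinite_Card_order_limit[OF l] .
  define bounded where "bounded = (\<lambda>S. \<exists>b\<in>Field l. \<forall>a\<in>S. (a,b) \<in> l)"
  define cof where "cof = (\<lambda>S. S \<subseteq> Field l \<and> \<not> bounded S)"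
  have "\<not> bounded (Field l)"
    unfolding bounded_def using nomax an by blast
  then have "{|S| | S. cof S} \<noteq> {}" unfolding cof_def by blast
  moreover have "\<forall>r\<in>{|S| | S. cof S}. Card_order r" using card_of_Card_order by blast
  ultimately have "\<exists>r\<in>{|S| | S. cof S}. \<forall>r'\<in>{|S| | S. cof S}. r \<le>o r'"
    by (rule exists_minim_Card_order)
  then obtain C where C: "cof C" and Cmin: "\<And>S. cof S \<Longrightarrow> |C| \<le>o |S|" by blast
  have small: "bounded S" if "S \<subseteq> Field l" "|S| <o |C|" for S
    using Cmin[of S] that unfolding cof_def using not_ordLess_ordLeq by blast
  have finb: "bounded S" if "finite S" "S \<subseteq> Field l" for S
    using that
  proof induction
    case empty
    then show ?case using infinite_imp_nonempty[OF l(2)] unfolding bounded_def by auto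
  next
    case (insert a S)
    then obtain b where "b \<in> Field l" "\<forall>a\<in>S. (a,b) \<in> l" unfolding bounded_def by auto
    moreover have "a \<in> Field l" using insert by simp
    ultimately show ?case unfolding bounded_def using tot tr by (metis insert_iff)
  qed
  have Cinf: "infinite C" using C finb unfolding cof_def by blast
  show ?thesis
  proof (cases "|C| \<le>o |UNIV :: 'a set|")
    case True
    then obtain h :: "'i \<Rightarrow> 'a" where h: "inj_on h C"
      using card_of_ordLeq[of C "UNIV :: 'a set"] by blast
    define D where "D = (\<lambda>c. Inl (h c) :: 'a + nat) ` C"
    have bij: "bij_betw (\<lambda>c. Inl (h c) :: 'a + nat) C D"
      using h unfolding D_def by (auto simp: bij_betw_def inj_on_def)
    then have DC: "|D| =o |C|" using card_of_ordIso ordIso_symmetric by blast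
    obtain e where e: "bij_betw e D C" using bij bij_betw_inv by blast
    have Dinf: "infinite D" using bij Cinf bij_betw_finite by blast
    define m where "m = |D|"
    have m: "Card_order m" "Field m = D" unfolding m_def
      by (simp_all add: card_of_card_order_on Field_card_of)
    have "\<exists>b\<in>Field l. \<forall>a\<in>e ` underS m d. (a,b) \<in> l" if "d \<in> D" for d
    proof -
      have "|underS m d| <o m" using card_of_underS m that by metis
      then have "|e ` underS m d| <o |C|"
        using card_of_image DC unfolding m_def
        by (meson ordLeq_ordLess_trans ordLess_ordIso_trans)
      moreover have "underS m d \<subseteq> D" using m(2) unfolding underS_def Field_def by blast
      then have "e ` underS m d \<subseteq> Field l"
        using e C unfolding bij_betw_def cof_def by blast
      ultimately show ?thesis using small unfolding bounded_def by blast
    qed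
    then have "\<forall>d\<in>D. \<exists>b. b \<in> Field l \<and> (\<forall>a\<in>underS m d. (e a, b) \<in> l)" by blast
    then have "\<exists>g. \<forall>d\<in>D. g d \<in> Field l \<and> (\<forall>a\<in>underS m d. (e a, g d) \<in> l)"
      by (rule bchoice)
    then obtain g where g: "\<And>d. d \<in> D \<Longrightarrow> g d \<in> Field l"
      "\<And>d a. d \<in> D \<Longrightarrow> a \<in> underS m d \<Longrightarrow> (e a, g d) \<in> l" by blast
    have "transfinite_converges X m (s \<circ> g) x"
      unfolding transfinite_converges_def
    proof (intro conjI allI impI)
      show "(s \<circ> g) ` Field m \<subseteq> topspace X" using m g(1) top by auto
      fix U assume "openin X U \<and> x \<in> U"
      then obtain b where b: "b \<in> Field l" "s ` aboveS l b \<subseteq> U" using nb by blast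
      obtain b' where b': "b' \<in> Field l" "b \<noteq> b'" "(b,b') \<in> l" using nomax b by blast
      have "\<not> bounded C" "C \<subseteq> Field l" using C unfolding cof_def by auto
      then obtain c where "c \<in> C" "(b',c) \<in> l"
        using b' tot unfolding bounded_def by (meson subsetD)
      then obtain d where d: "d \<in> D" "(b', e d) \<in> l"
        using e unfolding bij_betw_def by blast
      have "(s \<circ> g) ` aboveS m d \<subseteq> U"
      proof
        fix y assume "y \<in> (s \<circ> g) ` aboveS m d"
        then obtain i where i: "i \<in> aboveS m d" "y = s (g i)" by auto
        have iD: "i \<in> D" using i(1) m by (auto simp: aboveS_def Field_def)
        have "d \<in> underS m i" using i(1) by (auto simp: aboveS_def underS_def)
        then have "(e d, g i) \<in> l" using g(2) iD by blast
        then have "(b', g i) \<in> l" using d tr by blast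
        then have "g i \<in> aboveS l b"
          using b' tr an unfolding aboveS_def by blast
        then show "y \<in> U" using b i by blast
      qed
      then show "\<exists>b\<in>Field m. (s \<circ> g) ` aboveS m b \<subseteq> U" using d m by blast
    qed (use m Dinf top in auto)
    moreover have "(s \<circ> g) ` Field m \<subseteq> A" using m g(1) sA by auto
    ultimately show ?thesis by blast
  next
    case False
    then have big: "|UNIV :: 'a set| <o |C|"
      using not_ordLeq_iff_ordLess[OF card_of_Well_order card_of_Well_order] by blast
    have "\<exists>y. \<not> bounded {i \<in> Field l. s i = y}"
    proof (rule ccontr)
      assume "\<nexists>y. \<not> bounded {i \<in> Field l. s i = y}"
      then have "\<forall>y. \<exists>b. b \<in> Field l \<and> (\<forall>i\<in>Field l. s i = y \<longrightarrow> (i, b) \<in> l)"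
        unfolding bounded_def by simp blast
      then have "\<exists>b. \<forall>y. b y \<in> Field l \<and> (\<forall>i\<in>Field l. s i = y \<longrightarrow> (i, b y) \<in> l)"
        by (rule choice)
      then obtain b where b: "\<And>y. b y \<in> Field l"
        "\<And>y i. i \<in> Field l \<Longrightarrow> s i = y \<Longrightarrow> (i, b y) \<in> l"
        by blast
      have "|range b| <o |C|" using ordLeq_ordLess_trans[OF card_of_image big] .
      then have "bounded (range b)" using small b(1) by blast
      then have "bounded (Field l)" unfolding bounded_def using b(2) tr by blast
      then show False using \<open>\<not> bounded (Field l)\<close> by blast
    qed
    then obtain y where y: "\<not> bounded {i \<in> Field l. s i = y}" by blast
    have "{i \<in> Field l. s i = y} \<noteq> {}"
      using y finb[OF finite.emptyI empty_subsetI] by metis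
    then have yA: "y \<in> A" "y \<in> topspace X" using sA top by auto
    have yU: "y \<in> U" if U: "openin X U" "x \<in> U" for U
    proof -
      obtain b where b: "b \<in> Field l" "s ` aboveS l b \<subseteq> U" using nb U by blast
      obtain i where "i \<in> Field l" "s i = y" "(i,b) \<notin> l"
        using y b unfolding bounded_def by blast
      then have "i \<in> aboveS l b" using tot b unfolding aboveS_def by blast
      then show ?thesis using b \<open>s i = y\<close> by blast
    qed
    define m where "m = |range (Inr :: nat \<Rightarrow> 'a + nat)|"
    have m: "Card_order m" "Field m = range Inr" unfolding m_def
      by (simp_all add: card_of_card_order_on Field_card_of)
    have "infinite (Field m)" unfolding m by (simp add: finite_image_iff)
    then have "transfinite_converges X m (\<lambda>_. y) x"
      unfolding transfinite_converges_def using m yA top yU by auto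
    then show ?thesis using yA by (intro exI[of _ m] exI[of _ "\<lambda>_. y"]) auto
  qed
qed

end

theory Submission
  imports Defs
begin

text \<open>An almost closed set \<open>B \<subseteq> A\<close> converging to \<open>x\<close> has closure \<open>Y = B \<union> {x}\<close>.  By regularity and
  initial \<open>\<kappa>\<close>-compactness, a family of at most \<open>\<kappa>\<close> neighbourhoods of \<open>x\<close> meeting \<open>Y\<close> only in \<open>x\<close>
  shrinks to a local subbase of \<open>x\<close> in \<open>Y\<close>.  Since \<open>\<chi>(X) \<le> \<kappa>\<^sup>+\<close>, the point \<open>x\<close> therefore has a local
  subbase in \<open>Y\<close> of size the pseudocharacter \<open>\<psi>(x, Y)\<close>.  Enumerating it in order type \<open>\<psi>(x, Y)\<close>, one
  picks each term of the sequence in \<open>B\<close> and in all the earlier subbase elements; this is possible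
  since there are fewer than \<open>\<psi>(x, Y)\<close> of them.\<close>

text \<open>This is a local pseudobase at \<open>x\<close> of the subspace \<open>Y\<close>, given
  by open sets of the whole space; the least cardinality of such a family is the pseudocharacter of
  \<open>x\<close> in \<open>Y\<close>.\<close>

definition pseudobase_in :: "'a topology \<Rightarrow> 'a set \<Rightarrow> 'a \<Rightarrow> 'a set set \<Rightarrow> bool" where
  "pseudobase_in X Y x \<V> \<longleftrightarrow> x \<in> Y \<and> (\<forall>V\<in>\<V>. openin X V \<and> x \<in> V) \<and>
     (\<forall>y\<in>Y. (\<forall>V\<in>\<V>. y \<in> V) \<longrightarrow> y = x)"

text \<open>Finite intersections are left implicit, so that families can be compared in size without
  counting their finite subsets.\<close>

definition subbase_in :: "'a topology \<Rightarrow> 'a set \<Rightarrow> 'a \<Rightarrow> 'a set set \<Rightarrow> bool" where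
  "subbase_in X Y x \<W> \<longleftrightarrow> (\<forall>W\<in>\<W>. openin X W \<and> x \<in> W) \<and>
     (\<forall>U. openin X U \<and> x \<in> U \<longrightarrow> (\<exists>\<F>\<subseteq>\<W>. finite \<F> \<and> Y \<inter> \<Inter>\<F> \<subseteq> U))"

lemma local_base_at_imp_subbase_in:
  assumes "local_base_at X x \<B>"
  shows "subbase_in X Y x \<B>"
  unfolding subbase_in_def
proof (intro conjI allI impI)
  show "\<forall>W\<in>\<B>. openin X W \<and> x \<in> W" using assms unfolding local_base_at_def by blast
  fix U assume "openin X U \<and> x \<in> U"
  then obtain B where "B \<in> \<B>" "B \<subseteq> U" using assms unfolding local_base_at_def by blast
  then show "\<exists>\<F>\<subseteq>\<B>. finite \<F> \<and> Y \<inter> \<Inter>\<F> \<subseteq> U" by (intro exI[of _ "{B}"]) auto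
qed

text \<open>By T1, every point other than \<open>x\<close> is missed by some basic set. This
  supplies a first pseudobase, so that one of least cardinality can be chosen.\<close>

lemma local_base_at_imp_pseudobase_in:
  assumes T1: "t1_space X" and Y: "Y \<subseteq> topspace X" "x \<in> Y" and \<B>: "local_base_at X x \<B>"
  shows "pseudobase_in X Y x \<B>"
proof -
  have "y = x" if y: "y \<in> Y" "\<forall>B\<in>\<B>. y \<in> B" for y
  proof (rule ccontr)
    assume "y \<noteq> x"
    then obtain U where U: "openin X U" "x \<in> U" "y \<notin> U"
      using T1 Y y unfolding t1_space_def by (metis subsetD)
    then obtain B where "B \<in> \<B>" "B \<subseteq> U" using \<B> unfolding local_base_at_def by blast
    then show False using y U by blast
  qed
  then show ?thesis using \<B> Y unfolding pseudobase_in_def local_base_at_def by blast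
qed

text \<open>Regularity shrinks each \<open>V\<close> to a neighbourhood \<open>w V\<close> of
  \<open>x\<close> with closure inside \<open>V\<close>. The closures still meet \<open>Y\<close>
  only in \<open>x\<close>, so compactness leaves only finitely many of them to handle outside a
  given \<open>U\<close>.\<close>

lemma subbase_in_of_pseudobase_in:
  fixes \<kappa> :: "'k rel" and X :: "'a topology"
  assumes \<kappa>: "Card_order \<kappa>" "infinite (Field \<kappa>)"
    and compact: "initially_compact \<kappa> X" and regular: "regular_space X"
    and Y: "closedin X Y"
    and \<V>: "pseudobase_in X Y x \<V>" "|\<V>| \<le>o \<kappa>"
  shows "\<exists>\<W>. subbase_in X Y x \<W> \<and> |\<W>| \<le>o |\<V>|"
proof -
  have V: "openin X V" "x \<in> V" if "V \<in> \<V>" for V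
    using \<V>(1) that unfolding pseudobase_in_def by auto
  have int: "x \<in> Y" "\<And>y. y \<in> Y \<Longrightarrow> (\<And>V. V \<in> \<V> \<Longrightarrow> y \<in> V) \<Longrightarrow> y = x"
    using \<V>(1) unfolding pseudobase_in_def by blast+
  have xX: "x \<in> topspace X" using int closedin_subset[OF Y] by blast
  have "\<exists>W. openin X W \<and> x \<in> W \<and> X closure_of W \<subseteq> V" if V_in: "V \<in> \<V>" for V
  proof -
    have "\<exists>W C. openin X W \<and> closedin X C \<and> x \<in> W \<and> W \<subseteq> C \<and> C \<subseteq> V"
      using neighbourhood_base_of_closedin[THEN iffD2, OF regular] V[OF V_in]
      unfolding neighbourhood_base_of by simp
    then show ?thesis by (meson closure_of_minimal subset_trans)
  qed
  then have "\<forall>V\<in>\<V>. \<exists>W. openin X W \<and> x \<in> W \<and> X closure_of W \<subseteq> V" by blast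
  then have "\<exists>w. \<forall>V\<in>\<V>. openin X (w V) \<and> x \<in> w V \<and> X closure_of (w V) \<subseteq> V"
    by (rule bchoice)
  then obtain w where w: "\<And>V. V \<in> \<V> \<Longrightarrow> openin X (w V) \<and> x \<in> w V \<and> X closure_of (w V) \<subseteq> V"
    by blast
  have "subbase_in X Y x (w ` \<V>)"
    unfolding subbase_in_def
  proof (intro conjI allI impI)
    show "\<forall>W\<in>w ` \<V>. openin X W \<and> x \<in> W" using w by blast
    fix U assume U: "openin X U \<and> x \<in> U"
    define co where "co V = topspace X - X closure_of (w V)" for V
    \<comment> \<open>This covers the space: a point of \<open>Y\<close> other than \<open>x\<close>
      misses some \<open>V\<close>, hence lies in \<open>co V\<close>; the point \<open>x\<close>
      lies in \<open>U\<close>; all other points lie outside \<open>Y\<close>.\<close>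
    define \<U> where "\<U> = {U, topspace X - Y} \<union> co ` \<V>"
    have "openin X Z" if "Z \<in> \<U>" for Z
      using that U Y unfolding \<U>_def co_def by auto
    moreover have "\<Union>\<U> = topspace X"
    proof
      show "\<Union>\<U> \<subseteq> topspace X"
        using calculation openin_subset by blast
      show "topspace X \<subseteq> \<Union>\<U>"
      proof
        fix y assume y: "y \<in> topspace X"
        show "y \<in> \<Union>\<U>"
        proof (cases "y \<in> Y \<and> y \<noteq> x")
          case True
          then obtain V where "V \<in> \<V>" "y \<notin> V" using int by blast
          then have "y \<in> co V" using w y unfolding co_def by blast
          then show ?thesis using \<open>V \<in> \<V>\<close> unfolding \<U>_def by blast
        next
          case False
          then show ?thesis using U y unfolding \<U>_def by blast
        qed
      qed
    qed
    moreover have "|\<U>| \<le>o \<kappa>"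
    proof -
      have "|co ` \<V>| \<le>o \<kappa>" using card_of_image \<V>(2) ordLeq_transitive by blast
      moreover have "|{U, topspace X - Y}| <o \<kappa>"
        by (rule finite_ordLess_infinite)
          (use \<kappa> in \<open>auto simp: Field_card_of card_of_well_order_on intro: card_order_on_well_order_on\<close>)
      ultimately show ?thesis
        unfolding \<U>_def using card_of_Un_ordLeq_infinite_Field[OF \<kappa>(2) _ _ \<kappa>(1)] ordLess_imp_ordLeq by blast
    qed
    ultimately obtain \<F> where \<F>: "\<F> \<subseteq> \<U>" "finite \<F>" "\<Union>\<F> = topspace X"
      using compact[unfolded initially_compact_def, rule_format, of \<U>] by blast
    have "finite (\<F> \<inter> co ` \<V>)" using \<F> by blast
    then obtain F where F: "F \<subseteq> \<V>" "finite F" "\<F> \<inter> co ` \<V> = co ` F"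
      by (metis finite_subset_image inf_le2)
    \<comment> \<open>A point of \<open>Y\<close> in every \<open>w V\<close> with \<open>V\<close>
      in \<open>F\<close> avoids the complement of \<open>Y\<close> and each \<open>co V\<close> of
      the subcover, so only \<open>U\<close> can cover it.\<close>
    have "Y \<inter> \<Inter>(w ` F) \<subseteq> U"
    proof
      fix y assume y: "y \<in> Y \<inter> \<Inter>(w ` F)"
      then have "y \<in> topspace X" using closedin_subset[OF Y] by blast
      then obtain Z where Z: "Z \<in> \<F>" "y \<in> Z" using \<F> by blast
      have "Z \<notin> co ` F"
      proof
        assume "Z \<in> co ` F"
        then obtain V where V: "V \<in> F" "Z = co V" by blast
        moreover have "w V \<subseteq> X closure_of (w V)"
          using V w F by (meson closure_of_subset openin_subset subsetD)
        ultimately show False using y Z unfolding co_def by blast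
      qed
      then have "Z \<in> {U, topspace X - Y}" using Z \<F>(1) F(3) unfolding \<U>_def by blast
      then show "y \<in> U" using y Z by blast
    qed
    then show "\<exists>\<F>\<subseteq>w ` \<V>. finite \<F> \<and> Y \<inter> \<Inter>\<F> \<subseteq> U"
      using F(1,2) by (intro exI[of _ "w ` F"]) auto
  qed
  then show ?thesis using card_of_image by blast
qed

text \<open>A finite pseudobase would have an open intersection around \<open>x\<close>, which must
  meet \<open>B\<close>; but the only point of \<open>Y\<close> in it is \<open>x\<close>, which is
  not in \<open>B\<close>.\<close>

lemma infinite_pseudobase_in:
  assumes "x \<in> X closure_of B - B" "B \<subseteq> Y" "pseudobase_in X Y x \<V>"
  shows "infinite \<V>"
proof
  assume fin: "finite \<V>"
  have V: "openin X V" "x \<in> V" if "V \<in> \<V>" for V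
    using assms(3) that unfolding pseudobase_in_def by auto
  have int: "x \<in> Y" "\<And>y. y \<in> Y \<Longrightarrow> (\<And>V. V \<in> \<V> \<Longrightarrow> y \<in> V) \<Longrightarrow> y = x"
    using assms(3) unfolding pseudobase_in_def by blast+
  \<comment> \<open>Intersecting with \<open>topspace X\<close> covers the empty family, whose
    \<open>\<Inter>\<close> is \<open>UNIV\<close>.\<close>
  have "openin X (topspace X \<inter> \<Inter>\<V>)"
  proof (cases "\<V> = {}")
    case False
    then have "openin X (\<Inter>\<V>)" using fin V by (intro openin_Inter) blast+
    then show ?thesis by (intro openin_Int) simp_all
  qed simp
  moreover have "x \<in> topspace X \<inter> \<Inter>\<V>"
    using assms(1) V by (simp add: in_closure_of)
  ultimately obtain y where "y \<in> B" "y \<in> \<Inter>\<V>"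
    using assms(1) unfolding in_closure_of Diff_iff by blast
  then show False using int assms(1,2) by blast
qed

lemma finite_bounded_above:
  assumes "finite S" "S \<subseteq> Field l" "Well_order l" "Field l \<noteq> {}"
  shows "\<exists>b\<in>Field l. \<forall>a\<in>S. (a, b) \<in> l"
  using assms(1,2)
proof induction
  case empty
  then show ?case using assms(4) by auto
next
  case (insert a S)
  then obtain b where b: "b \<in> Field l" "\<forall>a\<in>S. (a, b) \<in> l" by auto
  have wo: "wo_rel l" using assms(3) by (simp add: wo_rel_def)
  have "(a, b) \<in> l \<or> (b, a) \<in> l" using wo_rel.TOTALS[OF wo] b insert by auto
  moreover have "(a, a) \<in> l"
    using wo_rel.REFL[OF wo] insert by (simp add: refl_on_def)
  ultimately show ?case
    using b insert.prems wo_rel.TRANS[OF wo] by (auto dest: transD)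
qed

text \<open>The well-order on \<open>\<V>\<close> serves as index set. Convergence needs only
  finitely many subbase elements at a time, and their positions have a common upper bound.\<close>

lemma transfinite_converges_of_subbase_in:
  fixes X :: "'a topology"
  assumes Y: "Y \<subseteq> topspace X" "x \<in> Y" and inf: "infinite \<V>"
    and least: "\<And>\<C>. pseudobase_in X Y x \<C> \<Longrightarrow> |\<V>| \<le>o |\<C>|"
    and \<W>: "subbase_in X Y x \<W>" "|\<W>| \<le>o |\<V>|"
  shows "\<exists>s. s ` \<V> \<subseteq> Y - {x} \<and> transfinite_converges X |\<V>| s x"
proof -
  let ?l = "|\<V>|"
  \<comment> \<open>The injection \<open>g\<close> gives each subbase element a position in the
    well-order; \<open>before d\<close> collects those placed strictly before
    \<open>d\<close>.\<close>
  obtain g where g: "inj_on g \<W>" "g ` \<W> \<subseteq> \<V>"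
    using \<W>(2) card_of_ordLeq[of \<W> \<V>] by blast
  define before where "before d = {W \<in> \<W>. g W \<in> underS ?l d}" for d
  have "\<exists>y. y \<in> Y - {x} \<and> (\<forall>W\<in>before d. y \<in> W)" if d: "d \<in> \<V>" for d
  proof (rule ccontr)
    \<comment> \<open>Otherwise \<open>before d\<close> would be a pseudobase, yet it embeds into a
      proper initial segment of a cardinal order and so is smaller than \<open>\<V>\<close>.\<close>
    assume no: "\<nexists>y. y \<in> Y - {x} \<and> (\<forall>W\<in>before d. y \<in> W)"
    have "before d \<subseteq> \<W>" unfolding before_def by blast
    then have "\<forall>W\<in>before d. openin X W \<and> x \<in> W"
      using \<W>(1) unfolding subbase_in_def by auto
    moreover have "\<forall>y\<in>Y. (\<forall>W\<in>before d. y \<in> W) \<longrightarrow> y = x" using no by auto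
    ultimately have "pseudobase_in X Y x (before d)"
      unfolding pseudobase_in_def using Y(2) by (intro conjI)
    then have "?l \<le>o |before d|" by (rule least)
    moreover have "|before d| \<le>o |underS ?l d|"
    proof (rule card_of_ordLeqI)
      show "inj_on g (before d)" using g(1) unfolding before_def by (rule inj_on_subset) blast
    qed (simp add: before_def)
    moreover have "|underS ?l d| <o ?l"
      by (rule card_of_underS[OF card_of_Card_order]) (use d in \<open>simp only: Field_card_of\<close>)
    ultimately have "|before d| <o |before d|"
      by (meson ordLeq_ordLess_trans ordLess_ordLeq_trans)
    then show False by (simp add: ordLess_irreflexive)
  qed
  then have "\<forall>d\<in>\<V>. \<exists>y. y \<in> Y - {x} \<and> (\<forall>W\<in>before d. y \<in> W)" by blast
  then have "\<exists>s. \<forall>d\<in>\<V>. s d \<in> Y - {x} \<and> (\<forall>W\<in>before d. s d \<in> W)"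
    by (rule bchoice)
  then obtain s where s: "\<And>d. d \<in> \<V> \<Longrightarrow> s d \<in> Y - {x} \<and> (\<forall>W\<in>before d. s d \<in> W)"
    by blast
  have "transfinite_converges X ?l s x"
    unfolding transfinite_converges_def
  proof (intro conjI allI impI)
    fix U assume "openin X U \<and> x \<in> U"
    then obtain \<F> where \<F>: "\<F> \<subseteq> \<W>" "finite \<F>" "Y \<inter> \<Inter>\<F> \<subseteq> U"
      using \<W>(1) unfolding subbase_in_def by blast
    have "\<exists>b\<in>Field ?l. \<forall>a\<in>g ` \<F>. (a, b) \<in> ?l"
      by (rule finite_bounded_above)
        (use \<F> g inf in \<open>auto simp: Field_card_of card_of_well_order_on\<close>)
    then obtain b where b: "b \<in> Field ?l" "\<And>W. W \<in> \<F> \<Longrightarrow> (g W, b) \<in> ?l" by blast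
    have "s d \<in> U" if d: "d \<in> aboveS ?l b" for d
    proof -
      have bd: "(b, d) \<in> ?l" "b \<noteq> d" using d unfolding aboveS_def by auto
      then have dV: "d \<in> \<V>" using FieldI2[OF bd(1)] by (simp add: Field_card_of)
      \<comment> \<open>Since \<open>g W\<close> is at most \<open>b\<close> and \<open>b\<close> is
        strictly below \<open>d\<close>, the term \<open>s d\<close> was chosen inside
        \<open>W\<close>.\<close>
      have "W \<in> before d" if W: "W \<in> \<F>" for W
      proof -
        have wo: "wo_rel ?l" by (simp add: wo_rel_def card_of_Well_order)
        have "(g W, d) \<in> ?l" using wo_rel.TRANS[OF wo] b(2)[OF W] bd(1) by (rule transD)
        moreover have "g W \<noteq> d"
          using wo_rel.ANTISYM[OF wo] b(2)[OF W] bd by (auto dest: antisymD)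
        ultimately show ?thesis using W \<F>(1) unfolding before_def underS_def by blast
      qed
      then show ?thesis using s[OF dV] \<F>(3) by blast
    qed
    then show "\<exists>b\<in>Field ?l. s ` aboveS ?l b \<subseteq> U" using b(1) by blast
  qed (use s Y inf in \<open>auto simp: Field_card_of card_of_card_order_on\<close>)
  then show ?thesis using s by blast
qed

theorem proposition3p9:
  fixes \<kappa> :: "'k rel" and X :: "'a topology"
  assumes "Card_order \<kappa>" and "infinite (Field \<kappa>)"
    and "initially_compact \<kappa> X"
    and "weakly_Whyburn X"
    and "regular_space X" and "Hausdorff_space X"
    and "character X \<le>o cardSuc \<kappa>"
  shows "pseudoradial X"
  unfolding pseudoradial_def
proof (intro allI impI)
  fix A assume "A \<subseteq> topspace X" "\<not> closedin X A"
  then obtain B x where BA: "B \<subseteq> A" "x \<notin> A" and B: "B \<subseteq> topspace X" "X closure_of B - B = {x}"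
    using assms(4) unfolding weakly_Whyburn_def almost_closed_converging_def by metis
  define Y where "Y = X closure_of B"
  have Y: "closedin X Y" "Y \<subseteq> topspace X" "x \<in> Y" "B \<subseteq> Y" "Y - {x} \<subseteq> B"
    using B closure_of_subset[OF B(1)] closure_of_subset_topspace[of X B] unfolding Y_def by auto
  have xA: "x \<in> X closure_of A - A"
    using Y(3) closure_of_mono[OF BA(1), of X] BA(2) unfolding Y_def by blast
  have "local_character X x \<le>o cardSuc \<kappa>"
    using assms(7) character_ordLeq_iff[OF cardSuc_Card_order[OF assms(1)], of X] Y(2,3) by auto
  then obtain \<B> where \<B>: "local_base_at X x \<B>" "|\<B>| \<le>o cardSuc \<kappa>"
    using local_character_ordLeq_iff[OF subsetD[OF Y(2,3)]] by auto
  have "pseudobase_in X Y x \<B>"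
    by (rule local_base_at_imp_pseudobase_in[OF Hausdorff_imp_t1_space[OF assms(6)] Y(2,3) \<B>(1)])
  then have "{|\<C>| | \<C>. pseudobase_in X Y x \<C>} \<noteq> {}" by blast
  moreover have "\<forall>r\<in>{|\<C>| | \<C>. pseudobase_in X Y x \<C>}. Card_order r"
    using card_of_Card_order by blast
  ultimately have "\<exists>r\<in>{|\<C>| | \<C>. pseudobase_in X Y x \<C>}.
      \<forall>r'\<in>{|\<C>| | \<C>. pseudobase_in X Y x \<C>}. r \<le>o r'"
    by (rule exists_minim_Card_order)
  then obtain \<V> where \<V>: "pseudobase_in X Y x \<V>"
    and least: "\<And>\<C>. pseudobase_in X Y x \<C> \<Longrightarrow> |\<V>| \<le>o |\<C>|" by blast
  have inf: "infinite \<V>" using infinite_pseudobase_in[OF _ Y(4) \<V>] B by blast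
  \<comment> \<open>Up to \<open>\<kappa>\<close>, compactness applies. Beyond it,
    \<open>\<V>\<close> has at least \<open>cardSuc \<kappa>\<close> elements, so the local base
    \<open>\<B>\<close> is already small enough.\<close>
  have "\<exists>\<W>. subbase_in X Y x \<W> \<and> |\<W>| \<le>o |\<V>|"
  proof (cases "|\<V>| \<le>o \<kappa>")
    case True
    then show ?thesis using subbase_in_of_pseudobase_in[OF assms(1-3,5) Y(1) \<V>] by blast
  next
    case False
    then have "\<kappa> <o |\<V>|"
      using not_ordLeq_iff_ordLess[OF card_order_on_well_order_on[OF assms(1)] card_of_Well_order]
      by blast
    then have "cardSuc \<kappa> \<le>o |\<V>|"
      using cardSuc_ordLess_ordLeq[OF assms(1) card_of_Card_order] by blast
    with \<B>(2) have "|\<B>| \<le>o |\<V>|" by (rule ordLeq_transitive)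
    then show ?thesis using local_base_at_imp_subbase_in[OF \<B>(1)] by blast
  qed
  then obtain s where s: "s ` \<V> \<subseteq> Y - {x}" "transfinite_converges X |\<V>| s x"
    using transfinite_converges_of_subbase_in[OF Y(2,3) inf least] by blast
  then have "s ` Field |\<V>| \<subseteq> A" using Y(5) BA(1) by (auto simp: Field_card_of)
  \<comment> \<open>The indices of \<open>s\<close> are open sets, of type \<open>'a set\<close>;
    \<open>pseudoradial_witnessI\<close> transfers the sequence to indices of type
    \<open>'a + nat\<close>.\<close>
  then show "\<exists>x\<in>X closure_of A - A. \<exists>(l :: ('a + nat) rel) s.
      s ` Field l \<subseteq> A \<and> transfinite_converges X l s x"
    using pseudoradial_witnessI[OF s(2)] by (intro bexI[OF _ xA])
qed

end
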